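(* $\mathsf{T}=\binom{\mathcal{B}_\mathrm{T}}{\mathcal{B}_\Gamma}$; that is, for a set of reals $X$, no Borel image of $X$ in $[\mathbb{N}]^\infty$ is a tower if and only if every countable Borel $\tau$-cover of $X$ contains a (Borel) $\gamma$-cover of $X$.
   Context: All spaces $X$ are infinite sets of reals; all covers considered are assumed not to contain $X$ as a member. A cover is a $\gamma$-cover of $X$ if it is infinite and each point lies in all but finitely many members; large if each point lies in infinitely many members. A large cover $\mathcal{U}$ is a $\tau$-cover if for all $x,y\in X$, either ($x\in U\Rightarrow y\in U$) for all but finitely many $U\in\mathcal{U}$, or ($y\in U\Rightarrow x\in U$) for all but finitely many $U\in\mathcal{U}$. $\mathcal{B}_\Gamma,\mathcal{B}_\mathrm{T}$ are the collections of countable Borel $\gamma$-, $\tau$-covers of $X$; $X$ satisfies $\binom{\mathcal{B}_\mathrm{T}}{\mathcal{B}_\Gamma}$ if every member of $\mathcal{B}_\mathrm{T}$ has a subcollection in $\mathcal{B}_\Gamma$. $[\mathbb{N}]^\infty$ is the space of infinite subsets of $\mathbb{N}$ (subspace of $P(\mathbb{N})\cong\{0,1\}^\mathbb{N}$). $a\subseteq^* b$ means $a\setminus b$ is finite. A pseudo-intersection of $Y\subseteq[\mathbb{N}]^\infty$ is an infinite $a\subseteq\mathbb{N}$ with $a\subseteq^*b$ for all $b\in Y$. A tower is a family $Y\subseteq[\mathbb{N}]^\infty$ linearly quasiordered by $\subseteq^*$ with no pseudo-intersection. A Borel image of $X$ in $Z$ is $f[X]$ for a Borel function $f:X\to Z$.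 $\mathsf{T}$ is the class of sets of reals $X$ such that no Borel image of $X$ in $[\mathbb{N}]^\infty$ is a tower. *)

theory Defs
  imports "HOL-Analysis.Analysis"
begin

section \<open>Covers\<close>

text \<open>Covers of a set of reals \<open>X\<close> consist of subsets of \<open>X\<close>; the trivial member
  \<open>X\<close> is excluded throughout. "All but finitely many members satisfy \<open>P\<close>" is written
  as finiteness of the set of exceptions.\<close>

definition cover_of :: "real set \<Rightarrow> real set set \<Rightarrow> bool" where
  "cover_of X \<U> \<longleftrightarrow> \<Union>\<U> = X \<and> X \<notin> \<U>"

definition gamma_cover :: "real set \<Rightarrow> real set set \<Rightarrow> bool" where
  "gamma_cover X \<U> \<longleftrightarrow> cover_of X \<U> \<and> infinite \<U> \<and> (\<forall>x\<in>X. finite {U \<in> \<U>. x \<notin> U})"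

definition large_cover :: "real set \<Rightarrow> real set set \<Rightarrow> bool" where
  "large_cover X \<U> \<longleftrightarrow> cover_of X \<U> \<and> (\<forall>x\<in>X. infinite {U \<in> \<U>. x \<in> U})"

definition tau_cover :: "real set \<Rightarrow> real set set \<Rightarrow> bool" where
  "tau_cover X \<U> \<longleftrightarrow> large_cover X \<U> \<and>
     (\<forall>x\<in>X. \<forall>y\<in>X. finite {U \<in> \<U>. \<not> (x \<in> U \<longrightarrow> y \<in> U)} \<or>
                  finite {U \<in> \<U>. \<not> (y \<in> U \<longrightarrow> x \<in> U)})"

text \<open>Borel means Borel in the subspace \<open>X\<close>, i.e. the trace on \<open>X\<close> of a Borel set of
  reals; \<open>X\<close> itself is arbitrary.\<close>

definition countable_Borel_family :: "real set \<Rightarrow> real set set \<Rightarrow> bool" where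
  "countable_Borel_family X \<U> \<longleftrightarrow> countable \<U> \<and> \<U> \<subseteq> sets (restrict_space borel X)"

definition B_Gamma :: "real set \<Rightarrow> real set set set" where
  "B_Gamma X = {\<U>. countable_Borel_family X \<U> \<and> gamma_cover X \<U>}"

definition B_Tau :: "real set \<Rightarrow> real set set set" where
  "B_Tau X = {\<U>. countable_Borel_family X \<U> \<and> tau_cover X \<U>}"

text \<open>The class of spaces (infinite sets of reals) satisfying \<open>\<AA>\<close> choose \<open>\<BB>\<close>.\<close>

definition cover_choose ::
    "(real set \<Rightarrow> real set set set) \<Rightarrow> (real set \<Rightarrow> real set set set) \<Rightarrow> real set set" where
  "cover_choose \<AA> \<BB> = {X. infinite X \<and> (\<forall>\<U>\<in>\<AA> X. \<exists>\<V>\<in>\<BB> X. \<V> \<subseteq> \<U>)}"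

section \<open>Towers and Borel images\<close>

definition almost_subset :: "nat set \<Rightarrow> nat set \<Rightarrow> bool" (infix "\<subseteq>\<^sup>*" 50) where
  "a \<subseteq>\<^sup>* b \<longleftrightarrow> finite (a - b)"

definition pseudo_intersection :: "nat set \<Rightarrow> nat set set \<Rightarrow> bool" where
  "pseudo_intersection a Y \<longleftrightarrow> infinite a \<and> (\<forall>b\<in>Y. a \<subseteq>\<^sup>* b)"

definition tower :: "nat set set \<Rightarrow> bool" where
  "tower Y \<longleftrightarrow> (\<forall>a\<in>Y. infinite a) \<and> (\<forall>a\<in>Y. \<forall>b\<in>Y. a \<subseteq>\<^sup>* b \<or> b \<subseteq>\<^sup>* a) \<and>
     \<not> (\<exists>a. pseudo_intersection a Y)"

text \<open>The topology on the power set of the naturals is transported from the product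
  topology on \<^typ>\<open>nat \<Rightarrow> bool\<close> (with \<^typ>\<open>bool\<close> discrete) along characteristic
  functions.\<close>

definition powerset_topology :: "nat set topology" where
  "powerset_topology = pullback_topology UNIV (\<lambda>a n. n \<in> a) (euclidean :: (nat \<Rightarrow> bool) topology)"

definition infinite_sets_topology :: "nat set topology" where
  "infinite_sets_topology = subtopology powerset_topology {a. infinite a}"

definition Borel_algebra :: "'a topology \<Rightarrow> 'a measure" where
  "Borel_algebra T = sigma (topspace T) {U. openin T U}"

definition Borel_image :: "real set \<Rightarrow> nat set set \<Rightarrow> bool" where
  "Borel_image X Y \<longleftrightarrow>
     (\<exists>f \<in> restrict_space borel X \<rightarrow>\<^sub>M Borel_algebra infinite_sets_topology. Y = f ` X)"

definition class_T :: "real set set" where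
  "class_T = {X. infinite X \<and> \<not> (\<exists>Y. Borel_image X Y \<and> tower Y)}"

lemma topspace_infinite_sets_topology: "topspace infinite_sets_topology = {a. infinite a}"
  by (simp add: infinite_sets_topology_def powerset_topology_def topspace_pullback_topology)

lemma openin_powerset_topology_member: "openin powerset_topology {a. n \<in> a}"
proof -
  have "open {g :: nat \<Rightarrow> bool. g n}"
  proof -
    have "open ((\<lambda>g :: nat \<Rightarrow> bool. g n) -` {True})"
      by (intro open_vimage open_discrete) (simp add: continuous_on_product_coordinates)
    then show ?thesis by (simp add: vimage_def)
  qed
  then show ?thesis
    unfolding powerset_topology_def openin_pullback_topology
    by (intro exI[of _ "{g. g n}"]) auto
qed

lemma openin_powerset_topology_nonmember: "openin powerset_topology {a. n \<notin> a}"
proof -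
  have "open {g :: nat \<Rightarrow> bool. \<not> g n}"
  proof -
    have "open ((\<lambda>g :: nat \<Rightarrow> bool. g n) -` {False})"
      by (intro open_vimage open_discrete) (simp add: continuous_on_product_coordinates)
    then show ?thesis by (simp add: vimage_def)
  qed
  then show ?thesis
    unfolding powerset_topology_def openin_pullback_topology
    by (intro exI[of _ "{g. \<not> g n}"]) auto
qed

lemma space_Borel_algebra: "space (Borel_algebra T) = topspace T"
  by (simp add: Borel_algebra_def space_measure_of_conv)

lemma sets_Borel_algebra: "sets (Borel_algebra T) = sigma_sets (topspace T) {U. openin T U}"
  unfolding Borel_algebra_def by (rule sets_measure_of) (auto dest: openin_subset)

end

theory Submission
  imports Defs
begin

text \<open>
  A sequence \<open>U\<close> of Borel subsets of \<open>X\<close> and a Borel map \<open>f\<close> from \<open>X\<close> into the power set of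
  the naturals encode each other through \<open>f x = {n. x \<in> U n}\<close>. Under this correspondence
  \<open>\<tau>\<close>-covers give families linearly quasiordered by \<open>\<subseteq>\<^sup>*\<close>, and \<open>\<gamma>\<close>-subcovers give
  pseudo-intersections. A sequence obtained from \<open>f\<close> may however repeat members or contain \<open>X\<close>.
  Since \<open>X\<close> is infinite, this is repaired by toggling in each \<open>U n\<close> a single point \<open>p n\<close> of
  \<open>X\<close>, with \<open>p\<close> injective: every \<open>f x\<close> then changes in at most one element.
\<close>

section \<open>Borel maps into the infinite sets of naturals\<close>

instance bool :: second_countable_topology
proof
  have "open = generate_topology (UNIV :: bool set set)"
    by (intro ext) (simp add: open_discrete generate_topology.Basis)
  then show "\<exists>B :: bool set set. countable B \<and> open = generate_topology B"
    by (intro exI[of _ UNIV]) (simp add: countable_finite)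
qed

text \<open>Containing \<open>n\<close> is an open condition on a set of naturals. This decodes a
  Borel map into a sequence of Borel sets.\<close>

lemma Borel_coordinate_set:
  assumes "f \<in> M \<rightarrow>\<^sub>M Borel_algebra infinite_sets_topology"
  shows "{x \<in> space M. n \<in> f x} \<in> sets M"
proof -
  let ?I = "{a. infinite a} :: nat set set"
  have "openin infinite_sets_topology (?I \<inter> {a. n \<in> a})"
    unfolding infinite_sets_topology_def
    by (rule openin_subtopology_Int2) (rule openin_powerset_topology_member)
  then have "?I \<inter> {a. n \<in> a} \<in> sets (Borel_algebra infinite_sets_topology)"
    by (simp add: sets_Borel_algebra sigma_sets.Basic)
  from measurable_sets[OF assms this]
  have "f -` (?I \<inter> {a. n \<in> a}) \<inter> space M \<in> sets M" .
  moreover have "infinite (f x)" if "x \<in> space M" for x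
    using measurable_space[OF assms that]
    by (simp add: space_Borel_algebra topspace_infinite_sets_topology)
  then have "f -` (?I \<inter> {a. n \<in> a}) \<inter> space M = {x \<in> space M. n \<in> f x}"
    by auto
  ultimately show ?thesis
    by simp
qed

text \<open>Open sets generate the Borel algebra, and each is the trace of a preimage under
  characteristic functions. So it suffices that the characteristic function of \<open>f x\<close>
  depends measurably on \<open>x\<close>.\<close>

lemma measurable_infinite_setsI:
  assumes inf: "\<And>x. x \<in> space M \<Longrightarrow> infinite (f x)"
    and coord: "\<And>n. {x \<in> space M. n \<in> f x} \<in> sets M"
  shows "f \<in> M \<rightarrow>\<^sub>M Borel_algebra infinite_sets_topology"
proof -
  \<comment> \<open>As \<open>bool\<close> is second countable and the index set is countable,
    measurability into \<open>nat \<Rightarrow> bool\<close> can be tested on coordinates.\<close>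
  have chi: "(\<lambda>x n. n \<in> f x) \<in> borel_measurable M"
  proof (rule measurable_coordinatewise_then_product)
    fix n
    have "(\<lambda>x. n \<in> f x) \<in> M \<rightarrow>\<^sub>M count_space UNIV"
      using coord[of n] by (simp add: pred_def)
    then show "(\<lambda>x. n \<in> f x) \<in> borel_measurable M"
      by (rule measurable_compose) simp
  qed
  show ?thesis
    unfolding Borel_algebra_def
  proof (rule measurable_measure_of)
    show "{U. openin infinite_sets_topology U} \<subseteq> Pow (topspace infinite_sets_topology)"
      by (auto dest: openin_subset)
    show "f \<in> space M \<rightarrow> topspace infinite_sets_topology"
      using inf by (simp add: topspace_infinite_sets_topology)
    fix A assume "A \<in> {U. openin infinite_sets_topology U}"
    then obtain W :: "(nat \<Rightarrow> bool) set"
      where W: "open W" "A = (\<lambda>a n. n \<in> a) -` W \<inter> {a. infinite a}"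
      unfolding infinite_sets_topology_def powerset_topology_def openin_subtopology
        openin_pullback_topology by auto
    have "f -` A \<inter> space M = (\<lambda>x n. n \<in> f x) -` W \<inter> space M"
      using W inf by auto
    also have "\<dots> \<in> sets M"
      using chi W by (intro measurable_sets) auto
    finally show "f -` A \<inter> space M \<in> sets M" .
  qed
qed

section \<open>Toggling single points\<close>

lemma inj_sym_diff_singleton: "inj (\<lambda>p. sym_diff A {p})"
  by (rule injI) auto

text \<open>The points are chosen recursively. For fixed \<open>n\<close>, toggling different points
  gives different sets, so each of the finitely many forbidden sets (\<open>X\<close> and the
  earlier results) rules out at most one point. As \<open>X\<close> is infinite, some point remains
  that also differs from all earlier ones.\<close>

lemma distinct_toggled_sequence:
  fixes U :: "nat \<Rightarrow> 'a set"
  assumes "infinite X"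
  obtains p where "range p \<subseteq> X" "inj p" "inj (\<lambda>n. sym_diff (U n) {p n})"
    "X \<notin> range (\<lambda>n. sym_diff (U n) {p n})"
proof -
  define V where "V n q = sym_diff (U n) {q}" for n q
  have injV: "inj (V n)" for n
    using inj_sym_diff_singleton unfolding V_def .
  have "\<exists>p. \<forall>n. p n \<in> X - p ` {..<n} \<and> V n (p n) \<notin> insert X ((\<lambda>m. V m (p m)) ` {..<n})"
  proof (rule dependent_wellorder_choice)
    fix r n and f g :: "nat \<Rightarrow> 'a"
    assume "\<And>m. m < n \<Longrightarrow> f m = g m"
    then show "(r \<in> X - f ` {..<n} \<and> V n r \<notin> insert X ((\<lambda>m. V m (f m)) ` {..<n})) \<longleftrightarrow>
        (r \<in> X - g ` {..<n} \<and> V n r \<notin> insert X ((\<lambda>m. V m (g m)) ` {..<n}))"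
      by (simp cong: image_cong_simp)
  next
    fix n and f :: "nat \<Rightarrow> 'a"
    let ?F = "insert X ((\<lambda>m. V m (f m)) ` {..<n})"
    have "finite (V n -` ?F)"
      by (rule finite_vimageI[OF _ injV]) simp
    then have "infinite (X - (f ` {..<n} \<union> V n -` ?F))"
      using assms by (intro Diff_infinite_finite) auto
    then obtain r where "r \<in> X - (f ` {..<n} \<union> V n -` ?F)"
      using infinite_imp_nonempty by blast
    then show "\<exists>r. r \<in> X - f ` {..<n} \<and> V n r \<notin> ?F"
      by (intro exI[of _ r]) simp
  qed
  then obtain p where p: "\<And>n. p n \<in> X - p ` {..<n}"
      "\<And>n. V n (p n) \<notin> insert X ((\<lambda>m. V m (p m)) ` {..<n})"
    by blast
  show thesis
  proof (rule that)
    show "range p \<subseteq> X"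
      using p(1) by auto
    show "inj p"
      using p(1) by (intro linorder_injI) (metis DiffD2 imageI lessThan_iff)
    show "inj (\<lambda>n. sym_diff (U n) {p n})"
      unfolding V_def[symmetric]
      using p(2) by (intro linorder_injI) (metis (no_types, lifting) imageI insertCI lessThan_iff)
    show "X \<notin> range (\<lambda>n. sym_diff (U n) {p n})"
      unfolding V_def[symmetric] using p(2) by (metis insertCI rangeE)
  qed
qed

section \<open>Covers in terms of index sets\<close>

lemma finite_image_Collect_iff:
  assumes "inj V"
  shows "finite {W \<in> V ` A. P W} \<longleftrightarrow> finite {n \<in> A. P (V n)}"
proof -
  have "{W \<in> V ` A. P W} = V ` {n \<in> A. P (V n)}"
    by auto
  then show ?thesis
    using assms by (simp add: finite_image_iff inj_on_subset)
qed

text \<open>Injectivity of \<open>V\<close> allows members to be counted by their indices. Covering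
  is then automatic: a point in infinitely many \<open>V n\<close> lies in at least one.\<close>

lemma large_cover_range_iff:
  assumes "inj V" "\<And>n. V n \<subseteq> X" "\<And>n. V n \<noteq> X"
  shows "large_cover X (range V) \<longleftrightarrow> (\<forall>x\<in>X. infinite {n. x \<in> V n})"
proof -
  have fin: "finite {W \<in> range V. x \<in> W} \<longleftrightarrow> finite {n. x \<in> V n}" for x
    using finite_image_Collect_iff[OF assms(1), of UNIV "\<lambda>W. x \<in> W"] by simp
  have "X \<notin> range V"
    using assms(3) by (metis rangeE)
  moreover have "\<Union> (range V) = X" if inf: "\<forall>x\<in>X. infinite {n. x \<in> V n}"
  proof
    show "\<Union> (range V) \<subseteq> X"
      using assms(2) by (rule UN_least)
    show "X \<subseteq> \<Union> (range V)"
    proof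
      fix x assume "x \<in> X"
      with inf have "{n. x \<in> V n} \<noteq> {}"
        by (intro infinite_imp_nonempty) simp
      then show "x \<in> \<Union> (range V)"
        by auto
    qed
  qed
  ultimately show ?thesis
    unfolding large_cover_def cover_of_def fin by meson
qed

text \<open>The members containing \<open>x\<close> but not \<open>y\<close> are indexed by the
  difference of the two index sets.\<close>

lemma tau_cover_range_iff:
  assumes "inj V" "\<And>n. V n \<subseteq> X" "\<And>n. V n \<noteq> X"
  shows "tau_cover X (range V) \<longleftrightarrow> (\<forall>x\<in>X. infinite {n. x \<in> V n}) \<and>
    (\<forall>x\<in>X. \<forall>y\<in>X. {n. x \<in> V n} \<subseteq>\<^sup>* {n. y \<in> V n} \<or> {n. y \<in> V n} \<subseteq>\<^sup>* {n. x \<in> V n})"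
  using finite_image_Collect_iff[OF assms(1), of UNIV] large_cover_range_iff[OF assms]
  by (simp add: tau_cover_def almost_subset_def set_diff_eq)

text \<open>Here too covering comes for free: for a point missed by every \<open>V n\<close> with
  \<open>n\<close> in \<open>a\<close>, the exceptional indices would be all of \<open>a\<close>,
  which is infinite.\<close>

lemma gamma_cover_image_iff:
  assumes "inj V" "\<And>n. V n \<subseteq> X" "\<And>n. V n \<noteq> X"
  shows "gamma_cover X (V ` a) \<longleftrightarrow> pseudo_intersection a ((\<lambda>x. {n. x \<in> V n}) ` X)"
proof -
  have "X \<notin> V ` a"
    using assms(3) by (metis imageE)
  moreover have "\<Union> (V ` a) = X" if a: "infinite a" "\<forall>x\<in>X. finite {n \<in> a. x \<notin> V n}"
  proof -
    have "\<exists>n\<in>a. x \<in> V n" if "x \<in> X" for x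
    proof (rule ccontr)
      assume "\<not> (\<exists>n\<in>a. x \<in> V n)"
      then have "{n \<in> a. x \<notin> V n} = a"
        by auto
      with a \<open>x \<in> X\<close> show False
        by metis
    qed
    with assms(2) show ?thesis
      by blast
  qed
  moreover have "finite (V ` a) \<longleftrightarrow> finite a"
    using assms(1) by (simp add: finite_image_iff inj_on_subset)
  ultimately show ?thesis
    using finite_image_Collect_iff[OF assms(1), of a]
    by (simp add: gamma_cover_def cover_of_def pseudo_intersection_def almost_subset_def
        set_diff_eq) meson
qed

section \<open>From the class of spaces without tower images to gamma-subcovers\<close>

lemma gamma_subcover_if_class_T:
  assumes X: "X \<in> class_T" and \<U>: "\<U> \<in> B_Tau X"
  shows "\<exists>\<V>\<in>B_Gamma X. \<V> \<subseteq> \<U>"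
proof -
  let ?M = "restrict_space borel X :: real measure"
  have "infinite X"
    using X by (simp add: class_T_def)
  then obtain x where "x \<in> X"
    using infinite_imp_nonempty by blast
  have \<U>': "countable \<U>" "\<U> \<subseteq> sets ?M" "tau_cover X \<U>"
    using \<U> by (auto simp: B_Tau_def countable_Borel_family_def)
  then have "infinite {U \<in> \<U>. x \<in> U}" "X \<notin> \<U>" "\<Union> \<U> = X"
    using \<open>x \<in> X\<close> by (auto simp: tau_cover_def large_cover_def cover_of_def)
  then have "infinite \<U>"
    by auto
  \<comment> \<open>The cover is infinite, since \<open>x\<close> already lies in infinitely many
    members, so this enumeration has no repetitions.\<close>
  define V where "V = from_nat_into \<U>"
  have V: "inj V" "range V = \<U>"
    using bij_betw_from_nat_into[OF \<open>countable \<U>\<close> \<open>infinite \<U>\<close>]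
    by (auto simp: V_def bij_betw_def)
  have VX: "V n \<subseteq> X" "V n \<noteq> X" "V n \<in> sets ?M" for n
    using V(2) \<U>'(2) \<open>X \<notin> \<U>\<close> \<open>\<Union> \<U> = X\<close> by auto
  define f where "f x = {n. x \<in> V n}" for x
  have tau: "infinite (f x)" "f x \<subseteq>\<^sup>* f y \<or> f y \<subseteq>\<^sup>* f x" if "x \<in> X" "y \<in> X" for x y
    using tau_cover_range_iff[OF V(1) VX(1,2)] \<U>'(3) that unfolding V(2) f_def by blast+
  have "f \<in> ?M \<rightarrow>\<^sub>M Borel_algebra infinite_sets_topology"
  proof (rule measurable_infinite_setsI)
    fix n
    have "{x \<in> space ?M. n \<in> f x} = V n"
      using VX(1)[of n] by (auto simp: f_def space_restrict_space)
    then show "{x \<in> space ?M. n \<in> f x} \<in> sets ?M"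
      using VX(3) by simp
  qed (use tau in \<open>simp add: space_restrict_space\<close>)
  then have "\<not> tower (f ` X)"
    using X by (auto simp: class_T_def Borel_image_def)
  \<comment> \<open>By \<open>tau\<close> the image meets the other two requirements on a tower, so
    only the absence of a pseudo-intersection can fail.\<close>
  then obtain a where "pseudo_intersection a (f ` X)"
    using tau unfolding tower_def by auto
  then have "gamma_cover X (V ` a)"
    using gamma_cover_image_iff[OF V(1) VX(1,2)] by (simp add: f_def[abs_def])
  moreover have "countable_Borel_family X (V ` a)" "V ` a \<subseteq> \<U>"
    using V(2) VX(3) by (auto simp: countable_Borel_family_def)
  ultimately show ?thesis
    by (auto simp: B_Gamma_def)
qed

section \<open>From gamma-subcovers to the absence of tower images\<close>

lemma almost_subset_trans: "a \<subseteq>\<^sup>* b \<Longrightarrow> b \<subseteq>\<^sup>* c \<Longrightarrow> a \<subseteq>\<^sup>* c"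
  unfolding almost_subset_def by (rule finite_subset[of _ "(a - b) \<union> (b - c)"]) auto

lemma class_T_if_cover_choose:
  assumes "X \<in> cover_choose B_Tau B_Gamma"
  shows "X \<in> class_T"
proof -
  let ?M = "restrict_space borel X :: real measure"
  have "infinite X" and choose: "\<And>\<U>. \<U> \<in> B_Tau X \<Longrightarrow> \<exists>\<V>\<in>B_Gamma X. \<V> \<subseteq> \<U>"
    using assms by (auto simp: cover_choose_def)
  have "\<not> tower (f ` X)" if f: "f \<in> ?M \<rightarrow>\<^sub>M Borel_algebra infinite_sets_topology" for f
  proof
    assume tower: "tower (f ` X)"
    obtain p where p: "range p \<subseteq> X" "inj p"
        and toggled: "inj (\<lambda>n. sym_diff {x \<in> X. n \<in> f x} {p n})"
          "X \<notin> range (\<lambda>n. sym_diff {x \<in> X. n \<in> f x} {p n})"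
      by (rule distinct_toggled_sequence[OF \<open>infinite X\<close>, of "\<lambda>n. {x \<in> X. n \<in> f x}"])
        (rule that)
    define V where "V n = sym_diff {x \<in> X. n \<in> f x} {p n}" for n
    have pX: "p n \<in> X" for n
      using p(1) by (simp add: image_subset_iff)
    have "inj V" and "X \<notin> range V"
      using toggled unfolding V_def[abs_def] .
    have VX: "V n \<noteq> X" for n
      using \<open>X \<notin> range V\<close> by (metis rangeI)
    have "V n \<subseteq> X" for n
      using pX[of n] by (auto simp: V_def)
    note V = \<open>inj V\<close> this VX
    have "V n \<in> sets ?M" for n
    proof -
      have "{x \<in> X. n \<in> f x} \<in> sets ?M"
        using Borel_coordinate_set[OF f, of n] by (simp add: space_restrict_space)
      moreover have "{p n} \<in> sets ?M"
        using pX[of n] by (auto simp: sets_restrict_space intro!: image_eqI[of _ _ "{p n}"])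
      ultimately show ?thesis
        unfolding V_def by (intro sets.Un sets.Diff)
    qed
    then have Borel: "countable_Borel_family X (range V)"
      by (auto simp: countable_Borel_family_def)
    define g where "g x = {n. x \<in> V n}" for x
    \<comment> \<open>Toggling affects \<open>x\<close> only at indices \<open>n\<close> with
      \<open>p n = x\<close>, and \<open>p\<close> is injective. Hence infinity, comparability and
      pseudo-intersections, all stable under finite changes, pass between \<open>f\<close> and
      \<open>g\<close>.\<close>
    have fg: "f x \<subseteq>\<^sup>* g x" "g x \<subseteq>\<^sup>* f x" if "x \<in> X" for x
    proof -
      have "finite (p -` {x})"
        using p(2) by (simp add: finite_vimageI)
      moreover have "f x - g x \<subseteq> p -` {x}" "g x - f x \<subseteq> p -` {x}"
        using that by (auto simp: g_def V_def)
      ultimately show "f x \<subseteq>\<^sup>* g x" "g x \<subseteq>\<^sup>* f x"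
        unfolding almost_subset_def by (auto intro: finite_subset)
    qed
    have "infinite (g x)" if "x \<in> X" for x
      using fg(1)[OF that] tower that
      by (auto simp: tower_def almost_subset_def dest: finite_Diff2)
    moreover have "g x \<subseteq>\<^sup>* g y \<or> g y \<subseteq>\<^sup>* g x" if "x \<in> X" "y \<in> X" for x y
    proof -
      have "f x \<subseteq>\<^sup>* f y \<or> f y \<subseteq>\<^sup>* f x"
        using tower that by (simp add: tower_def)
      then show ?thesis
        using fg that almost_subset_trans by meson
    qed
    ultimately have "tau_cover X (range V)"
      unfolding tau_cover_range_iff[OF V] g_def by blast
    with Borel have "range V \<in> B_Tau X"
      by (simp add: B_Tau_def)
    from choose[OF this] obtain \<V> where "gamma_cover X \<V>" "\<V> \<subseteq> range V"
      by (auto simp: B_Gamma_def)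
    \<comment> \<open>A subfamily of the range is indexed by some \<open>a\<close>, and this index
      set is the pseudo-intersection that contradicts the tower.\<close>
    then obtain a where "gamma_cover X (V ` a)"
      by (auto simp: subset_image_iff)
    then have a: "pseudo_intersection a (g ` X)"
      unfolding gamma_cover_image_iff[OF V] by (simp add: g_def[abs_def])
    then have "pseudo_intersection a (f ` X)"
      using fg(2) almost_subset_trans by (fastforce simp: pseudo_intersection_def)
    with tower show False
      by (auto simp: tower_def)
  qed
  with \<open>infinite X\<close> show ?thesis
    by (auto simp: class_T_def Borel_image_def)
qed

theorem theorem3p4:
  shows "class_T = cover_choose B_Tau B_Gamma"
proof (intro equalityI subsetI)
  show "X \<in> cover_choose B_Tau B_Gamma" if "X \<in> class_T" for X
    using that gamma_subcover_if_class_T by (auto simp: cover_choose_def class_T_def)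
qed (rule class_T_if_cover_choose)

end
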